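(* Let $A$ be an invertible linear map from $\mathbb R^4$ to $(\mathbb R^4)^*$ (a projective polarity). Then for any $X\in\mathbb R^4$, $$\det(A)\,\mathcal F''(AX)=\wedge^3(\vee^2A)\,\mathcal F(X).$$
   Context: Let $e_0,e_1,e_2,e_3$ be the standard orthonormal basis of $\mathbb R^4$ with dual basis $e_0^*,\dots,e_3^*$ of $(\mathbb R^4)^*$; $\det(A)$ is the determinant of the matrix of $A$ in these bases. Identify $\mathbb R^3=\mathrm{span}(e_1,e_2,e_3)$. $\mathbb R^{3,3}=\Lambda^2(\mathbb R^4)$ has basis $E_i=e_0\wedge e_i$ ($i=1,2,3$), $E_1'=e_2\wedge e_3$, $E_2'=e_3\wedge e_1$, $E_3'=e_1\wedge e_2$ and symmetric bilinear form $E_i\cdot E_j'=\delta_{ij}$, $E_i\cdot E_j=E_i'\cdot E_j'=0$. For $x\in\mathbb R^3$, $E(x)=\sum x_iE_i$, $E'(x)=\sum x_iE_i'$. The meet product $\vee:(\mathbb R^4)^*\times(\mathbb R^4)^*\to\mathbb R^{3,3}$ is the antisymmetric bilinear map with $e_0^*\vee e_i^*=E_i'$ and $e_i^*\vee e_j^*=E_k$ for positive (cyclic) permutations $ijk$ of $123$. The dual Plücker transform $\vee^2A$ of $A$ is the linear map of $\mathbb R^{3,3}$ with $(\vee^2A)(e_i\wedge e_j)=(Ae_i)\vee(Ae_j)$; $\wedge^3(\vee^2A)$ is the induced map on $\Lambda^3(\mathbb R^{3,3})$. In $\Lambda(\mathbb R^{3,3})$ put $I_3=E_1\wedge E_2\wedge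 E_3$, $J_3=E_1'\wedge E_2'\wedge E_3'$, $K_2=\sum_iE_i\wedge E_i'$; for a vector $a$, $a\cdot(b_1\wedge b_2\wedge b_3)=(a\cdot b_1)b_2\wedge b_3-(a\cdot b_2)b_1\wedge b_3+(a\cdot b_3)b_1\wedge b_2$. Define $$\mathcal F(x_0e_0+x)=E(x)\wedge(E(x)\cdot J_3)-x_0E(x)\wedge K_2+x_0^2I_3\quad(x\in\mathbb R^3),$$ $$\mathcal F''\Bigl(de_0^*+\sum_{i=1}^3n_ie_i^*\Bigr)=E'(n)\wedge(E'(n)\cdot I_3)+d\,E'(n)\wedge K_2+d^2J_3 .$$ *)

theory Defs
  imports "HOL-Analysis.Analysis"
begin

section \<open>The exterior algebra of \<open>real ^ 'n\<close>\<close>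

text \<open>
  The exterior algebra of \<open>real ^ 'n\<close> has the basis \<open>axis S 1\<close>, \<open>S \<subseteq> UNIV\<close>, where \<open>axis S 1\<close> is the
  product of the vectors \<open>axis i 1\<close>, \<open>i \<in> S\<close>, in increasing order of \<open>i\<close>.  The linear order on the
  index type only serves to name the basis.  Grade \<open>k\<close> is spanned by the \<open>axis S 1\<close> with \<open>card S = k\<close>.
\<close>

type_synonym 'n ext = "real ^ ('n set)"

definition merge_sign :: "'n::linorder set \<Rightarrow> 'n set \<Rightarrow> real" where
  "merge_sign S T = (- 1) ^ card {(i, j). i \<in> S \<and> j \<in> T \<and> j < i}"

definition blade_prod :: "'n::{finite,linorder} set \<Rightarrow> 'n set \<Rightarrow> 'n ext" where
  "blade_prod S T = (if S \<inter> T = {} then merge_sign S T *\<^sub>R axis (S \<union> T) 1 else 0)"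

definition ext_wedge :: "'n::{finite,linorder} ext \<Rightarrow> 'n ext \<Rightarrow> 'n ext"
    (infixr "\<^bold>\<and>" 72) where
  "\<omega> \<^bold>\<and> \<eta> = (\<Sum>S\<in>UNIV. \<Sum>T\<in>UNIV. (\<omega> $ S * \<eta> $ T) *\<^sub>R blade_prod S T)"

definition ext_vec :: "real ^ 'n::{finite,linorder} \<Rightarrow> 'n ext" where
  "ext_vec v = (\<Sum>i\<in>UNIV. v $ i *\<^sub>R axis {i} 1)"

text \<open>
  \<open>ext_contract a\<close> is the contraction with the linear form whose value on \<open>axis i 1\<close> is \<open>a $ i\<close>
  (see \<open>ext_contract_3\<close> below).
\<close>

definition ext_contract :: "real ^ 'n::{finite,linorder} \<Rightarrow> 'n ext \<Rightarrow> 'n ext" where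
  "ext_contract a \<omega> = (\<Sum>S\<in>UNIV. \<omega> $ S *\<^sub>R (\<Sum>i\<in>S. (a $ i * merge_sign {i} (S - {i})) *\<^sub>R axis (S - {i}) 1))"

text \<open>
  \<open>ext_map L\<close> is the algebra endomorphism induced by a linear map \<open>L\<close>; its restriction to grade \<open>k\<close>
  is \<open>\<wedge>\<^sup>k L\<close> (see \<open>ext_map_3\<close> below for \<open>k = 3\<close>).
\<close>

definition ext_map :: "(real ^ 'n::{finite,linorder} \<Rightarrow> real ^ 'n::{finite,linorder}) \<Rightarrow> 'n ext \<Rightarrow> 'n ext" where
  "ext_map L \<omega> =
     (\<Sum>S\<in>UNIV. \<omega> $ S *\<^sub>R
        foldr (\<lambda>i \<eta>. ext_vec (L (axis i 1)) \<^bold>\<and> \<eta>) (sorted_list_of_set S) (axis {} 1))"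

subsection \<open>Basic laws\<close>

lemma linear_eq_axis:
  fixes f g :: "real ^ 'm \<Rightarrow> 'b::real_vector"
  assumes "linear f" "linear g" "\<And>i. f (axis i 1) = g (axis i 1)"
  shows "f x = g x"
proof -
  have "f = g"
    by (rule linear_eq_stdbasis[OF assms(1,2)]) (use assms(3) in \<open>auto simp: Basis_vec_def\<close>)
  then show ?thesis by simp
qed

lemma eq_neg_imp_zero:
  fixes x :: "'b::real_vector"
  assumes "x = - x"
  shows "x = 0"
proof -
  have "2 *\<^sub>R x = x + x" by (rule scaleR_2)
  also have "\<dots> = 0" using assms by (simp only: eq_neg_iff_add_eq_0)
  finally show ?thesis by simp
qed

lemma linear_wedge_left: "linear (\<lambda>\<omega>. \<omega> \<^bold>\<and> \<eta>)"
  unfolding ext_wedge_def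
  by (rule linearI)
     (simp_all add: algebra_simps sum.distrib scaleR_sum_right)

lemma linear_wedge_right: "linear (\<lambda>\<eta>. \<omega> \<^bold>\<and> \<eta>)"
  unfolding ext_wedge_def
  by (rule linearI)
     (simp_all add: algebra_simps sum.distrib scaleR_sum_right)

lemma linear_ext_vec: "linear ext_vec"
  unfolding ext_vec_def
  by (rule linearI) (simp_all add: algebra_simps sum.distrib scaleR_sum_right)

lemma linear_ext_contract: "linear (ext_contract a)"
  unfolding ext_contract_def
  by (rule linearI) (simp_all add: algebra_simps sum.distrib scaleR_sum_right)

lemma linear_ext_contract_left: "linear (\<lambda>a. ext_contract a \<omega>)"
  unfolding ext_contract_def
  by (rule linearI) (simp_all add: algebra_simps sum.distrib scaleR_sum_right)

lemma linear_ext_map: "linear (ext_map L)"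
  unfolding ext_map_def
  by (rule linearI) (simp_all add: algebra_simps sum.distrib scaleR_sum_right)

lemmas wedge_linear_simps =
  linear_add[OF linear_wedge_left] linear_add[OF linear_wedge_right]
  linear_scale[OF linear_wedge_left] linear_scale[OF linear_wedge_right]
  linear_0[OF linear_wedge_left] linear_0[OF linear_wedge_right]
  linear_diff[OF linear_wedge_left] linear_diff[OF linear_wedge_right]
  linear_neg[OF linear_wedge_left] linear_neg[OF linear_wedge_right]
  linear_sum[OF linear_wedge_left] linear_sum[OF linear_wedge_right]

lemma sum_axis_scaleR:
  fixes f :: "'m::finite \<Rightarrow> 'b::real_vector"
  shows "(\<Sum>i\<in>UNIV. (axis k (1::real) $ i) *\<^sub>R f i) = f k"
proof -
  have "(\<Sum>i\<in>UNIV. (axis k (1::real) $ i) *\<^sub>R f i) = (\<Sum>i\<in>UNIV. if i = k then f i else 0)"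
    by (rule sum.cong) (auto simp: axis_def)
  then show ?thesis by simp
qed

lemma wedge_axis: "axis S 1 \<^bold>\<and> axis T 1 = blade_prod S T"
proof -
  have "axis S 1 \<^bold>\<and> axis T 1 =
      (\<Sum>S'\<in>UNIV. (axis S (1::real) $ S') *\<^sub>R (\<Sum>T'\<in>UNIV. (axis T (1::real) $ T') *\<^sub>R blade_prod S' T'))"
    by (simp add: ext_wedge_def scaleR_sum_right)
  then show ?thesis by (simp add: sum_axis_scaleR)
qed

lemma ext_vec_axis [simp]: "ext_vec (axis i 1) = axis {i} 1"
  unfolding ext_vec_def by (rule sum_axis_scaleR)

lemma ext_contract_axis:
  "ext_contract a (axis S 1) = (\<Sum>i\<in>S. (a $ i * merge_sign {i} (S - {i})) *\<^sub>R axis (S - {i}) 1)"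
  unfolding ext_contract_def by (rule sum_axis_scaleR)

lemma ext_map_axis:
  "ext_map L (axis S 1) =
     foldr (\<lambda>i \<eta>. ext_vec (L (axis i 1)) \<^bold>\<and> \<eta>) (sorted_list_of_set S) (axis {} 1)"
  unfolding ext_map_def by (rule sum_axis_scaleR)

lemma merge_sign_empty [simp]: "merge_sign {} T = 1" "merge_sign S {} = 1"
  by (simp_all add: merge_sign_def)

lemma merge_sign_union_left:
  fixes S :: "'n::{finite,linorder} set"
  assumes "S \<inter> T = {}"
  shows "merge_sign (S \<union> T) U = merge_sign S U * merge_sign T U"
proof -
  have "{(i, j). i \<in> S \<union> T \<and> j \<in> U \<and> j < i} =
      {(i, j). i \<in> S \<and> j \<in> U \<and> j < i} \<union> {(i, j). i \<in> T \<and> j \<in> U \<and> j < i}" by auto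
  moreover have "{(i, j). i \<in> S \<and> j \<in> U \<and> j < i} \<inter> {(i, j). i \<in> T \<and> j \<in> U \<and> j < i} = {}"
    using assms by auto
  ultimately show ?thesis
    by (simp add: merge_sign_def card_Un_disjoint power_add)
qed

lemma merge_sign_union_right:
  fixes S :: "'n::{finite,linorder} set"
  assumes "T \<inter> U = {}"
  shows "merge_sign S (T \<union> U) = merge_sign S T * merge_sign S U"
proof -
  have "{(i, j). i \<in> S \<and> j \<in> T \<union> U \<and> j < i} =
      {(i, j). i \<in> S \<and> j \<in> T \<and> j < i} \<union> {(i, j). i \<in> S \<and> j \<in> U \<and> j < i}" by auto
  moreover have "{(i, j). i \<in> S \<and> j \<in> T \<and> j < i} \<inter> {(i, j). i \<in> S \<and> j \<in> U \<and> j < i} = {}"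
    using assms by auto
  ultimately show ?thesis
    by (simp add: merge_sign_def card_Un_disjoint power_add)
qed

lemma merge_sign_single: "merge_sign {i} {j} = (if j < i then - 1 else 1)"
proof -
  have "{(i', j'). i' \<in> {i} \<and> j' \<in> {j} \<and> j' < i'} = (if j < i then {(i, j)} else {})" by auto
  then show ?thesis by (simp add: merge_sign_def)
qed

lemma merge_sign_insert:
  fixes T :: "'n::{finite,linorder} set"
  assumes "j \<notin> T"
  shows "merge_sign {i} (insert j T) = (if j < i then - 1 else 1) * merge_sign {i} T"
  using merge_sign_union_right[of "{j}" T "{i}"] assms by (simp add: merge_sign_single)

lemma merge_sign_less: "(\<forall>j\<in>T. i < j) \<Longrightarrow> merge_sign {i} T = 1"
proof -
  assume "\<forall>j\<in>T. i < j"
  then have none: "{(i', j). i' \<in> {i} \<and> j \<in> T \<and> j < i'} = {}" by force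
  show ?thesis unfolding merge_sign_def none by simp
qed

lemma merge_sign_square [simp]: "merge_sign S T * merge_sign S T = 1"
  unfolding merge_sign_def by (simp flip: power_mult_distrib)

lemma wedge_axis_single:
  "axis {i} 1 \<^bold>\<and> axis S 1 = (if i \<in> S then 0 else merge_sign {i} S *\<^sub>R axis (insert i S) 1)"
  by (auto simp: wedge_axis blade_prod_def)

lemma wedge_assoc: "(\<omega> \<^bold>\<and> \<eta>) \<^bold>\<and> \<zeta> = \<omega> \<^bold>\<and> (\<eta> \<^bold>\<and> \<zeta>)"
proof -
  have 1: "(axis S 1 \<^bold>\<and> axis T 1) \<^bold>\<and> axis U 1 = axis S 1 \<^bold>\<and> (axis T 1 \<^bold>\<and> axis U 1)"
    for S T U :: "'a set"
    by (auto simp: wedge_axis blade_prod_def wedge_linear_simps merge_sign_union_left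
        merge_sign_union_right Un_assoc Int_Un_distrib Int_Un_distrib2)
  have 2: "(axis S 1 \<^bold>\<and> axis T 1) \<^bold>\<and> \<zeta> = axis S 1 \<^bold>\<and> (axis T 1 \<^bold>\<and> \<zeta>)" for S T
    by (rule linear_eq_axis[where x = \<zeta>])
       (auto intro!: linearI simp: wedge_linear_simps 1)
  have 3: "(axis S 1 \<^bold>\<and> \<eta>) \<^bold>\<and> \<zeta> = axis S 1 \<^bold>\<and> (\<eta> \<^bold>\<and> \<zeta>)" for S
    by (rule linear_eq_axis[where x = \<eta>])
       (auto intro!: linearI simp: wedge_linear_simps 2)
  show ?thesis
    by (rule linear_eq_axis[where x = \<omega>])
       (auto intro!: linearI simp: wedge_linear_simps 3)
qed

lemmas vec_linear_simps = linear_add[OF linear_ext_vec] linear_scale[OF linear_ext_vec]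

lemma wedge_vec_anticomm: "ext_vec u \<^bold>\<and> ext_vec v = - (ext_vec v \<^bold>\<and> ext_vec u)"
proof -
  have lin: "linear (\<lambda>u. ext_vec u \<^bold>\<and> \<omega>)" "linear (\<lambda>u. - (\<omega> \<^bold>\<and> ext_vec u))" 
      "linear (\<lambda>v. \<omega> \<^bold>\<and> ext_vec v)" "linear (\<lambda>v. - (ext_vec v \<^bold>\<and> \<omega>))" for \<omega> :: "'a ext"
    by (auto intro!: linearI simp: wedge_linear_simps vec_linear_simps)
  have 1: "ext_vec (axis i 1) \<^bold>\<and> ext_vec (axis j 1) = - (ext_vec (axis j 1) \<^bold>\<and> ext_vec (axis i 1))"
    for i j :: 'a
    by (cases i j rule: linorder_cases)
       (auto simp: wedge_axis_single merge_sign_single insert_commute)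
  have 2: "ext_vec (axis i 1) \<^bold>\<and> ext_vec v = - (ext_vec v \<^bold>\<and> ext_vec (axis i 1))" for i :: 'a
    by (rule linear_eq_axis[OF lin(3,4) 1])
  show ?thesis
    by (rule linear_eq_axis[OF lin(1,2) 2])
qed

lemma wedge_vec_self: "ext_vec v \<^bold>\<and> ext_vec v = 0"
  by (rule eq_neg_imp_zero) (rule wedge_vec_anticomm)

lemma wedge_one [simp]: "\<omega> \<^bold>\<and> axis {} 1 = \<omega>" "axis {} 1 \<^bold>\<and> \<omega> = \<omega>"
  by (rule linear_eq_axis[where x = \<omega>],
      auto intro!: linearI simp: wedge_linear_simps wedge_axis blade_prod_def)+

lemma ext_contract_wedge:
  "ext_contract a (ext_vec v \<^bold>\<and> \<omega>) = (a \<bullet> v) *\<^sub>R \<omega> - ext_vec v \<^bold>\<and> ext_contract a \<omega>"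
proof -
  note simps = wedge_linear_simps vec_linear_simps linear_add[OF linear_ext_contract]
    linear_scale[OF linear_ext_contract] linear_0[OF linear_ext_contract]
  have key: "ext_contract a (axis {i} 1 \<^bold>\<and> axis S 1) =
      (a $ i) *\<^sub>R axis S 1 - axis {i} 1 \<^bold>\<and> ext_contract a (axis S 1)" for i S
  proof (cases "i \<in> S")
    case True
    have "axis {i} 1 \<^bold>\<and> ext_contract a (axis S 1) =
        (\<Sum>k\<in>S. if k = i then (a $ i) *\<^sub>R axis S 1 else 0)"
      unfolding ext_contract_axis wedge_linear_simps
    proof (rule sum.cong)
      fix k assume "k \<in> S"
      show "(a $ k * merge_sign {k} (S - {k})) *\<^sub>R (axis {i} 1 \<^bold>\<and> axis (S - {k}) 1) =
          (if k = i then (a $ i) *\<^sub>R axis S 1 else 0)"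
        using True by (cases "k = i") (simp_all add: wedge_axis_single insert_absorb mult.assoc)
    qed simp
    also have "\<dots> = (a $ i) *\<^sub>R axis S 1"
      using True by simp
    finally show ?thesis using True by (simp add: wedge_axis_single simps)
  next
    case False
    have square: "merge_sign {i} S * (a $ i * merge_sign {i} S) = a $ i"
      by (metis mult.left_commute mult.right_neutral merge_sign_square)
    have "ext_contract a (axis {i} 1 \<^bold>\<and> axis S 1) =
       (\<Sum>k\<in>insert i S. (merge_sign {i} S * (a $ k * merge_sign {k} (insert i S - {k}))) *\<^sub>R axis (insert i S - {k}) 1)"
      using False by (simp add: wedge_axis_single simps ext_contract_axis scaleR_sum_right del: sum.insert)
    also have "\<dots> = (a $ i) *\<^sub>R axis S 1 +
       (\<Sum>k\<in>S. (merge_sign {i} S * (a $ k * merge_sign {k} (insert i S - {k}))) *\<^sub>R axis (insert i S - {k}) 1)"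
      using False by (simp add: square)
    also have "(\<Sum>k\<in>S. (merge_sign {i} S * (a $ k * merge_sign {k} (insert i S - {k}))) *\<^sub>R axis (insert i S - {k}) (1::real))
      = (\<Sum>k\<in>S. - ((a $ k * merge_sign {k} (S - {k})) *\<^sub>R (axis {i} 1 \<^bold>\<and> axis (S - {k}) 1)))"
    proof (rule sum.cong)
      fix k assume k: "k \<in> S"
      with False have ne: "k \<noteq> i" by auto
      define T where "T = S - {k}"
      have T: "S = insert k T" "insert i S - {k} = insert i T" "i \<notin> T" "k \<notin> T"
        using k ne False by (auto simp: T_def)
      have "merge_sign {i} (insert k T) * (a $ k * merge_sign {k} (insert i T)) =
          - (a $ k * merge_sign {k} T * merge_sign {i} T)"
        using ne T(3,4) by (cases i k rule: linorder_cases) (simp_all add: merge_sign_insert)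
      then show "(merge_sign {i} S * (a $ k * merge_sign {k} (insert i S - {k}))) *\<^sub>R axis (insert i S - {k}) (1::real)
        = - ((a $ k * merge_sign {k} (S - {k})) *\<^sub>R (axis {i} 1 \<^bold>\<and> axis (S - {k}) 1))"
        using T(3) unfolding T(2) T_def[symmetric] by (simp add: T(1) wedge_axis_single)
    qed simp
    also have "\<dots> = - (axis {i} 1 \<^bold>\<and> ext_contract a (axis S 1))"
      by (simp add: ext_contract_axis wedge_linear_simps sum_negf)
    finally show ?thesis by simp
  qed
  have 2: "ext_contract a (ext_vec v \<^bold>\<and> axis S 1) =
      (a \<bullet> v) *\<^sub>R axis S 1 - ext_vec v \<^bold>\<and> ext_contract a (axis S 1)" for S
    by (rule linear_eq_axis[where x = v])
       (auto intro!: linearI simp: simps key inner_add_right scaleR_add_left inner_axis scaleR_diff_right)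
  show ?thesis
    by (rule linear_eq_axis[where x = \<omega>])
       (use 2 in \<open>auto intro!: linearI simp: simps scaleR_add_right scaleR_diff_right mult.commute\<close>)
qed

lemma ext_contract_one: "ext_contract a (axis {} 1) = 0"
  by (simp add: ext_contract_axis)

lemma ext_contract_vec: "ext_contract a (ext_vec v) = (a \<bullet> v) *\<^sub>R axis {} 1"
  using ext_contract_wedge[of a v "axis {} 1"] by (simp add: ext_contract_one wedge_linear_simps)

lemma ext_contract_3:
  "ext_contract a (ext_vec b1 \<^bold>\<and> ext_vec b2 \<^bold>\<and> ext_vec b3) =
     (a \<bullet> b1) *\<^sub>R (ext_vec b2 \<^bold>\<and> ext_vec b3) - (a \<bullet> b2) *\<^sub>R (ext_vec b1 \<^bold>\<and> ext_vec b3)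
     + (a \<bullet> b3) *\<^sub>R (ext_vec b1 \<^bold>\<and> ext_vec b2)"
  by (simp add: ext_contract_wedge ext_contract_vec wedge_linear_simps)

lemma wedge_vec_swap:
  "ext_vec u \<^bold>\<and> ext_vec v \<^bold>\<and> \<omega> = - (ext_vec v \<^bold>\<and> ext_vec u \<^bold>\<and> \<omega>)"
  by (metis wedge_assoc wedge_vec_anticomm linear_neg[OF linear_wedge_left])

lemma wedge_vec_self_left: "ext_vec v \<^bold>\<and> ext_vec v \<^bold>\<and> \<omega> = 0"
  by (metis wedge_assoc wedge_vec_self linear_0[OF linear_wedge_left])

lemma ext_map_wedge:
  assumes "linear L"
  shows "ext_map L (ext_vec v \<^bold>\<and> \<omega>) = ext_vec (L v) \<^bold>\<and> ext_map L \<omega>"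
proof -
  note simps = wedge_linear_simps vec_linear_simps linear_add[OF linear_ext_map]
    linear_scale[OF linear_ext_map] linear_0[OF linear_ext_map] linear_add[OF assms]
    linear_scale[OF assms]
  have cons: "ext_map L (axis (insert b S) 1) = ext_vec (L (axis b 1)) \<^bold>\<and> ext_map L (axis S 1)"
    if "\<forall>a\<in>S. b < a" for b S
  proof -
    have "b \<notin> S" using that by auto
    moreover have "insort b (sorted_list_of_set S) = b # sorted_list_of_set S"
      by (rule insort_is_Cons) (use that in \<open>auto simp: less_imp_le\<close>)
    ultimately have "sorted_list_of_set (insert b S) = b # sorted_list_of_set S"
      by (simp add: sorted_list_of_set_insert_remove)
    then show ?thesis by (simp add: ext_map_axis)
  qed
  have key: "ext_map L (axis {i} 1 \<^bold>\<and> axis S 1) = ext_vec (L (axis i 1)) \<^bold>\<and> ext_map L (axis S 1)" for i S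
  proof -
    have "finite S" by simp
    then show ?thesis
    proof (induction S rule: finite_linorder_min_induct)
      case empty
      then show ?case using cons[of "{}" i] by (simp add: wedge_axis_single)
    next
      case (insert b S)
      have bS: "b \<notin> S" using insert by auto
      consider "i < b" | "i = b" | "b < i" by force
      then show ?case
      proof cases
        case 1
        then have less: "\<forall>a\<in>insert b S. i < a" using insert by force
        then have "i \<notin> insert b S" by blast
        then show ?thesis using cons[OF less] merge_sign_less[OF less]
          by (simp add: wedge_axis_single)
      next
        case 2
        then show ?thesis
          by (simp add: wedge_axis_single simps cons[OF insert(2)] wedge_vec_self_left)
      next
        case 3
        have swap: "ext_vec (L (axis i 1)) \<^bold>\<and> ext_map L (axis (insert b S) 1) =
            - (ext_vec (L (axis b 1)) \<^bold>\<and> ext_map L (axis {i} 1 \<^bold>\<and> axis S 1))"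
          by (simp add: cons[OF insert(2)] insert(3) wedge_vec_swap[of "L (axis i 1)"])
        show ?thesis
        proof (cases "i \<in> S")
          case True
          then show ?thesis unfolding swap by (simp add: wedge_axis_single simps)
        next
          case False
          have "\<forall>a\<in>insert i S. b < a" using insert(2) 3 by auto
          from cons[OF this] False 3 bS show ?thesis unfolding swap
            by (simp add: wedge_axis_single simps merge_sign_insert insert_commute[of i b]
                linear_neg[OF linear_ext_map])
        qed
      qed
    qed
  qed
  have 2: "ext_map L (ext_vec v \<^bold>\<and> axis S 1) = ext_vec (L v) \<^bold>\<and> ext_map L (axis S 1)" for S
    by (rule linear_eq_axis[where x = v]) (auto intro!: linearI simp: simps key)
  show ?thesis
    by (rule linear_eq_axis[where x = \<omega>]) (use 2 in \<open>auto intro!: linearI simp: simps\<close>)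
qed

lemma ext_map_one: "ext_map L (axis {} 1) = axis {} 1"
  by (simp add: ext_map_axis)

lemma ext_map_3:
  assumes "linear L"
  shows "ext_map L (ext_vec a \<^bold>\<and> ext_vec b \<^bold>\<and> ext_vec c) =
    ext_vec (L a) \<^bold>\<and> ext_vec (L b) \<^bold>\<and> ext_vec (L c)"
  using ext_map_wedge[OF assms, of c "axis {} 1"] assms
  by (simp add: ext_map_wedge ext_map_one)


section \<open>The space \<open>\<real>\<^sup>3\<^sup>,\<^sup>3 = \<Lambda>\<^sup>2(\<real>\<^sup>4)\<close>\<close>

text \<open>
  The index set of the basis \<open>E\<^sub>1, E\<^sub>2, E\<^sub>3, E\<^sub>1', E\<^sub>2', E\<^sub>3'\<close>.  In the numeral types, \<open>3 = 0\<close> holds in type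
  \<open>3\<close>, and type \<open>4\<close> has the four elements \<open>0, 1, 2, 3\<close>, which index \<open>e\<^sub>0, e\<^sub>1, e\<^sub>2, e\<^sub>3\<close>.
\<close>

datatype pindex = IE 3 | IE' 3

lemma UNIV_pindex: "UNIV = range IE \<union> range IE'"
proof -
  have "p \<in> range IE \<union> range IE'" for p by (cases p) auto
  then show ?thesis by auto
qed

instance pindex :: finite
  by standard (simp add: UNIV_pindex)

instantiation pindex :: linorder
begin

definition less_eq_pindex :: "pindex \<Rightarrow> pindex \<Rightarrow> bool" where
  "p \<le> q = (case p of
      IE i \<Rightarrow> (case q of IE j \<Rightarrow> i \<le> j | IE' j \<Rightarrow> True)
    | IE' i \<Rightarrow> (case q of IE j \<Rightarrow> False | IE' j \<Rightarrow> i \<le> j))"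

definition less_pindex :: "pindex \<Rightarrow> pindex \<Rightarrow> bool" where
  "p < q = (p \<le> q \<and> p \<noteq> (q::pindex))"

instance
  by standard (auto simp: less_eq_pindex_def less_pindex_def split: pindex.splits)

end

type_synonym R33 = "real ^ pindex"

definition E :: "real ^ 3 \<Rightarrow> R33" where
  "E x = (\<Sum>i\<in>UNIV. x $ i *\<^sub>R axis (IE i) 1)"

definition E' :: "real ^ 3 \<Rightarrow> R33" where
  "E' x = (\<Sum>i\<in>UNIV. x $ i *\<^sub>R axis (IE' i) 1)"

definition form33 :: "R33 \<Rightarrow> R33 \<Rightarrow> real" where
  "form33 u v = (\<Sum>i\<in>UNIV. u $ IE i * v $ IE' i + u $ IE' i * v $ IE i)"

definition spatial :: "real ^ 4 \<Rightarrow> real ^ 3" where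
  "spatial X = vector [X $ 1, X $ 2, X $ 3]"

text \<open>
  The exterior product \<open>\<real>\<^sup>4 \<times> \<real>\<^sup>4 \<rightarrow> \<Lambda>\<^sup>2(\<real>\<^sup>4)\<close>, where \<open>E\<^sub>i = e\<^sub>0 \<and> e\<^sub>i\<close> and \<open>E\<^sub>k' = e\<^sub>i \<and> e\<^sub>j\<close> for cyclic \<open>ijk\<close>.
\<close>

definition join :: "real ^ 4 \<Rightarrow> real ^ 4 \<Rightarrow> R33" where
  "join X Y = E (X $ 0 *\<^sub>R spatial Y - Y $ 0 *\<^sub>R spatial X) + E' (cross3 (spatial X) (spatial Y))"

lemma E_E'_component [simp]:
  "E x $ IE i = x $ i" "E x $ IE' i = 0" "E' x $ IE i = 0" "E' x $ IE' i = x $ i"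
  by (simp_all add: E_def E'_def axis_def if_distrib cong: if_cong)

lemma linear_E: "linear E" and linear_E': "linear E'"
  unfolding E_def E'_def
  by (auto intro!: linearI simp: algebra_simps sum.distrib scaleR_sum_right)

lemma E_axis [simp]: "E (axis i 1) = axis (IE i) 1" and E'_axis [simp]: "E' (axis i 1) = axis (IE' i) 1"
  unfolding E_def E'_def by (rule sum_axis_scaleR)+

lemma form33_basis:
  "form33 (E (axis i 1)) (E' (axis j 1)) = (if i = j then 1 else 0)"
  "form33 (E' (axis i 1)) (E (axis j 1)) = (if i = j then 1 else 0)"
  "form33 (E x) (E y) = 0" "form33 (E' x) (E' y) = 0"
  by (simp_all add: form33_def del: E_axis E'_axis)
     (auto simp: axis_def if_distrib[where f = "\<lambda>x. x * _"] cong: if_cong)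

lemma spatial_axis:
  "spatial (axis 0 1) = 0"
  "spatial (axis 1 1) = axis 1 1" "spatial (axis 2 1) = axis 2 1" "spatial (axis 3 1) = axis 3 1"
  by (simp_all add: spatial_def vec_eq_iff forall_3 axis_def)

lemma cross3_axis:
  "cross3 (axis 2 1) (axis 3 1) = axis 1 1"
  "cross3 (axis 3 1) (axis 1 1) = axis 2 1"
  "cross3 (axis 1 1) (axis 2 1) = axis 3 1"
  by (simp_all add: cross3_def vec_eq_iff forall_3 axis_def)

lemma four_eq_0: "(4::4) = 0"
  by simp

lemma join_basis:
  "join (axis 0 1) (axis 1 1) = E (axis 1 1)"
  "join (axis 0 1) (axis 2 1) = E (axis 2 1)"
  "join (axis 0 1) (axis 3 1) = E (axis 3 1)"
  "join (axis 2 1) (axis 3 1) = E' (axis 1 1)"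
  "join (axis 3 1) (axis 1 1) = E' (axis 2 1)"
  "join (axis 1 1) (axis 2 1) = E' (axis 3 1)"
  by (simp_all add: join_def spatial_axis cross3_axis linear_0[OF linear_E] linear_0[OF linear_E']
      del: E_axis E'_axis) (simp_all add: axis_def linear_0[OF linear_E])

text \<open>
  The dual space of \<open>real ^ 4\<close> is the type \<open>(real ^ 4) \<Rightarrow>\<^sub>L real\<close>.  The coordinates of a form in the
  dual basis are its values on \<open>e\<^sub>0, e\<^sub>1, e\<^sub>2, e\<^sub>3\<close>.
\<close>

definition dual_basis :: "4 \<Rightarrow> ((real ^ 4) \<Rightarrow>\<^sub>L real)" where
  "dual_basis i = Blinfun (\<lambda>X. X $ i)"

definition dual_coords :: "((real ^ 4) \<Rightarrow>\<^sub>L real) \<Rightarrow> real ^ 4" where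
  "dual_coords \<phi> = (\<chi> i. blinfun_apply \<phi> (axis i 1))"

lemma dual_basis_apply [simp]: "blinfun_apply (dual_basis i) X = X $ i"
  unfolding dual_basis_def by (simp add: bounded_linear_Blinfun_apply bounded_linear_vec_nth)

lemma dual_coords_expansion: "\<phi> = (\<Sum>i\<in>UNIV. dual_coords \<phi> $ i *\<^sub>R dual_basis i)"
proof (rule blinfun_eqI)
  fix X
  show "blinfun_apply \<phi> X = blinfun_apply (\<Sum>i\<in>UNIV. dual_coords \<phi> $ i *\<^sub>R dual_basis i) X"
    by (rule linear_eq_axis[where x = X])
       (auto intro!: linearI simp: dual_coords_def blinfun.bilinear_simps blinfun.sum_left
          distrib_left sum.distrib sum_distrib_left mult.left_commute axis_def if_distrib cong: if_cong)
qed

lemma linear_dual_coords: "linear dual_coords"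
  by (rule linearI) (simp_all add: dual_coords_def vec_eq_iff blinfun.bilinear_simps)

lemma dual_coords_basis [simp]: "dual_coords (dual_basis i) = axis i 1"
  by (auto simp: dual_coords_def vec_eq_iff axis_def)

definition meet :: "((real ^ 4) \<Rightarrow>\<^sub>L real) \<Rightarrow> ((real ^ 4) \<Rightarrow>\<^sub>L real) \<Rightarrow> R33" where
  "meet \<phi> \<psi> = (let a = dual_coords \<phi>; b = dual_coords \<psi> in
     E (cross3 (spatial a) (spatial b)) + E' (a $ 0 *\<^sub>R spatial b - b $ 0 *\<^sub>R spatial a))"

lemma linear_spatial: "linear spatial"
  by (rule linearI) (simp_all add: spatial_def vec_eq_iff forall_3)

lemma meet_antisym: "meet \<phi> \<psi> = - meet \<psi> \<phi>"
  by (simp add: meet_def Let_def cross_skew[of "spatial (dual_coords \<phi>)"]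
      linear_neg[OF linear_E] linear_neg[OF linear_E'] linear_diff[OF linear_E'])

lemma linear_meet_left: "linear (\<lambda>\<phi>. meet \<phi> \<psi>)"
  by (rule linearI)
     (simp_all add: meet_def Let_def linear_add[OF linear_dual_coords] linear_scale[OF linear_dual_coords]
       linear_add[OF linear_spatial] linear_scale[OF linear_spatial] linear_add[OF linear_E]
       linear_scale[OF linear_E] linear_add[OF linear_E'] linear_diff[OF linear_E'] linear_scale[OF linear_E']
       cross_add_left cross_mult_left algebra_simps)

lemma linear_meet_right: "linear (meet \<phi>)"
proof -
  have "meet \<phi> = (\<lambda>\<psi>. - meet \<psi> \<phi>)"
    by (rule ext) (rule meet_antisym)
  then show ?thesis using linear_compose_neg[OF linear_meet_left] by simp
qed

lemma meet_basis:
  "meet (dual_basis 0) (dual_basis 1) = E' (axis 1 1)"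
  "meet (dual_basis 0) (dual_basis 2) = E' (axis 2 1)"
  "meet (dual_basis 0) (dual_basis 3) = E' (axis 3 1)"
  "meet (dual_basis 2) (dual_basis 3) = E (axis 1 1)"
  "meet (dual_basis 3) (dual_basis 1) = E (axis 2 1)"
  "meet (dual_basis 1) (dual_basis 2) = E (axis 3 1)"
  by (simp_all add: meet_def spatial_axis cross3_axis linear_0[OF linear_E] linear_0[OF linear_E']
      del: E_axis E'_axis) (simp_all add: axis_def linear_0[OF linear_E'])

text \<open>
  The images of the basis vectors \<open>e\<^sub>i \<and> e\<^sub>j\<close> are prescribed; \<open>dual_pluecker_join\<close> below extends the
  rule to all exterior products.
\<close>

definition dual_pluecker :: "(real ^ 4 \<Rightarrow> ((real ^ 4) \<Rightarrow>\<^sub>L real)) \<Rightarrow> R33 \<Rightarrow> R33" where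
  "dual_pluecker A u =
     u $ IE 1 *\<^sub>R meet (A (axis 0 1)) (A (axis 1 1))
   + u $ IE 2 *\<^sub>R meet (A (axis 0 1)) (A (axis 2 1))
   + u $ IE 3 *\<^sub>R meet (A (axis 0 1)) (A (axis 3 1))
   + u $ IE' 1 *\<^sub>R meet (A (axis 2 1)) (A (axis 3 1))
   + u $ IE' 2 *\<^sub>R meet (A (axis 3 1)) (A (axis 1 1))
   + u $ IE' 3 *\<^sub>R meet (A (axis 1 1)) (A (axis 2 1))"

lemma linear_dual_pluecker: "linear (dual_pluecker A)"
  unfolding dual_pluecker_def by (rule linearI) (simp_all add: algebra_simps)

lemma join_antisym: "join X Y = - join Y X"
  by (simp add: join_def cross_skew[of "spatial X"]
      linear_neg[OF linear_E] linear_neg[OF linear_E'] linear_diff[OF linear_E])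

lemma linear_join_left: "linear (\<lambda>X. join X Y)"
  by (rule linearI)
     (simp_all add: join_def
       linear_add[OF linear_spatial] linear_scale[OF linear_spatial] linear_add[OF linear_E]
       linear_scale[OF linear_E] linear_add[OF linear_E'] linear_diff[OF linear_E] linear_scale[OF linear_E']
       cross_add_left cross_mult_left algebra_simps)

lemma linear_join_right: "linear (join X)"
proof -
  have "join X = (\<lambda>Y. - join Y X)"
    by (rule ext) (rule join_antisym)
  then show ?thesis using linear_compose_neg[OF linear_join_left] by simp
qed

lemma dual_pluecker_join:
  assumes "linear A"
  shows "dual_pluecker A (join X Y) = meet (A X) (A Y)"
proof -
  have self: "meet \<phi> \<phi> = 0" for \<phi>
    by (rule eq_neg_imp_zero) (rule meet_antisym)
  have self': "join Z Z = 0" for Z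
    by (rule eq_neg_imp_zero) (rule join_antisym)
  have basis: "dual_pluecker A (join (axis 0 1) (axis 1 1)) = meet (A (axis 0 1)) (A (axis 1 1))"
    "dual_pluecker A (join (axis 0 1) (axis 2 1)) = meet (A (axis 0 1)) (A (axis 2 1))"
    "dual_pluecker A (join (axis 0 1) (axis 3 1)) = meet (A (axis 0 1)) (A (axis 3 1))"
    "dual_pluecker A (join (axis 2 1) (axis 3 1)) = meet (A (axis 2 1)) (A (axis 3 1))"
    "dual_pluecker A (join (axis 3 1) (axis 1 1)) = meet (A (axis 3 1)) (A (axis 1 1))"
    "dual_pluecker A (join (axis 1 1) (axis 2 1)) = meet (A (axis 1 1)) (A (axis 2 1))"
    unfolding join_basis by (simp_all add: dual_pluecker_def del: E_axis E'_axis) (simp_all add: axis_def)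
  have flip: "dual_pluecker A (join V U) = meet (A V) (A U)"
    if "dual_pluecker A (join U V) = meet (A U) (A V)" for U V
    using that join_antisym[of V U] meet_antisym[of "A V" "A U"]
    by (simp add: linear_neg[OF linear_dual_pluecker])
  have refl: "dual_pluecker A (join U U) = meet (A U) (A U)" for U
    by (simp add: self self' linear_0[OF linear_dual_pluecker])
  have "\<forall>i j::4. dual_pluecker A (join (axis i 1) (axis j 1)) = meet (A (axis i 1)) (A (axis j 1))"
    unfolding forall_4 four_eq_0 by (simp only: basis basis[THEN flip] refl simp_thms)
  note 1 = this[rule_format]
  note lin = linear_add linear_scale
  note simps = lin[OF linear_dual_pluecker] lin[OF linear_join_left] lin[OF linear_join_right]
    lin[OF linear_meet_left] lin[OF linear_meet_right] lin[OF assms]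
  have 2: "dual_pluecker A (join (axis i 1) Y) = meet (A (axis i 1)) (A Y)" for i
    by (rule linear_eq_axis[where x = Y]) (auto intro!: linearI simp: simps 1)
  show ?thesis
    by (rule linear_eq_axis[where x = X]) (auto intro!: linearI simp: simps 2)
qed


section \<open>The maps \<open>\<F>\<close> and \<open>\<F>''\<close>\<close>

definition contract33 :: "R33 \<Rightarrow> pindex ext \<Rightarrow> pindex ext" where
  "contract33 a = ext_contract (\<chi> p. form33 a (axis p 1))"

lemma linear_form33: "linear (form33 a)"
  by (rule linearI) (simp_all add: form33_def algebra_simps sum.distrib sum_distrib_left)

lemma contract33_3:
  "contract33 a (ext_vec b1 \<^bold>\<and> ext_vec b2 \<^bold>\<and> ext_vec b3) =
     form33 a b1 *\<^sub>R (ext_vec b2 \<^bold>\<and> ext_vec b3) - form33 a b2 *\<^sub>R (ext_vec b1 \<^bold>\<and> ext_vec b3)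
     + form33 a b3 *\<^sub>R (ext_vec b1 \<^bold>\<and> ext_vec b2)"
proof -
  have "(\<chi> p. form33 a (axis p 1)) \<bullet> b = form33 a b" for b
    by (rule linear_eq_axis[where x = b])
       (auto simp: linear_form33 inner_axis bounded_linear.linear[OF bounded_linear_inner_right])
  then show ?thesis by (simp add: contract33_def ext_contract_3)
qed

definition I3 :: "pindex ext" where
  "I3 = ext_vec (E (axis 1 1)) \<^bold>\<and> ext_vec (E (axis 2 1)) \<^bold>\<and> ext_vec (E (axis 3 1))"

definition J3 :: "pindex ext" where
  "J3 = ext_vec (E' (axis 1 1)) \<^bold>\<and> ext_vec (E' (axis 2 1)) \<^bold>\<and> ext_vec (E' (axis 3 1))"

definition K2 :: "pindex ext" where
  "K2 = (\<Sum>i\<in>UNIV. ext_vec (E (axis i 1)) \<^bold>\<and> ext_vec (E' (axis i 1)))"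

definition \<F> :: "real ^ 4 \<Rightarrow> pindex ext" where
  "\<F> X = (let x0 = X $ 0; x = spatial X in
     ext_vec (E x) \<^bold>\<and> contract33 (E x) J3 - x0 *\<^sub>R (ext_vec (E x) \<^bold>\<and> K2) + x0\<^sup>2 *\<^sub>R I3)"

definition \<F>'' :: "((real ^ 4) \<Rightarrow>\<^sub>L real) \<Rightarrow> pindex ext" where
  "\<F>'' \<phi> = (let d = dual_coords \<phi> $ 0; n = spatial (dual_coords \<phi>) in
     ext_vec (E' n) \<^bold>\<and> contract33 (E' n) I3 + d *\<^sub>R (ext_vec (E' n) \<^bold>\<and> K2) + d\<^sup>2 *\<^sub>R J3)"

definition polarity_matrix :: "(real ^ 4 \<Rightarrow> ((real ^ 4) \<Rightarrow>\<^sub>L real)) \<Rightarrow> real ^ 4 ^ 4" where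
  "polarity_matrix A = (\<chi> i j. dual_coords (A (axis j 1)) $ i)"

lemma dual_coords_eq_matrix_mult:
  assumes "linear A"
  shows "dual_coords (A X) = polarity_matrix A *v X"
  by (rule linear_eq_axis[OF linear_compose[OF assms linear_dual_coords, unfolded o_def]
        matrix_vector_mul_linear])
     (simp add: polarity_matrix_def vec_eq_iff matrix_vector_mult_basis column_def)

end

theory Submission
  imports Defs
begin

text \<open>
  The lines through a point \<open>X\<close> are spanned by \<open>X \<and> Y\<close>, \<open>X \<and> Z\<close>, \<open>X \<and> W\<close>.  The product of these three
  vectors of \<open>\<real>\<^sup>3\<^sup>,\<^sup>3\<close> is alternating and trilinear in \<open>Y, Z, W\<close>, and evaluation on the basis vectors shows
  that it equals \<open>det (X, Y, Z, W) \<F>(X)\<close>.  Interchanging the \<open>E\<^sub>i\<close> and \<open>E\<^sub>i'\<close> turns the exterior product of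
  vectors into the meet of forms and \<open>\<F>\<close> into \<open>\<F>''\<close>, so the meets of a form with three others have
  product \<open>det (\<phi>, \<psi>\<^sub>1, \<psi>\<^sub>2, \<psi>\<^sub>3) \<F>''(\<phi>)\<close>.  Since \<open>\<or>\<^sup>2A\<close> maps \<open>X \<and> Y\<close> to \<open>AX \<or> AY\<close>, and \<open>A\<close> multiplies
  determinants by \<open>det A\<close>, the identity follows for \<open>X \<noteq> 0\<close> by choosing \<open>Y, Z, W\<close> with
  \<open>det (X, Y, Z, W) \<noteq> 0\<close>.
\<close>

lemma det_4:
  fixes M :: "'a::comm_ring_1^4^4"
  shows "det M =
    M$0$0 * M$1$1 * M$2$2 * M$3$3 - M$0$0 * M$1$1 * M$2$3 * M$3$2
    - M$0$0 * M$1$2 * M$2$1 * M$3$3 + M$0$0 * M$1$2 * M$2$3 * M$3$1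
    + M$0$0 * M$1$3 * M$2$1 * M$3$2 - M$0$0 * M$1$3 * M$2$2 * M$3$1
    - M$0$1 * M$1$0 * M$2$2 * M$3$3 + M$0$1 * M$1$0 * M$2$3 * M$3$2
    + M$0$1 * M$1$2 * M$2$0 * M$3$3 - M$0$1 * M$1$2 * M$2$3 * M$3$0
    - M$0$1 * M$1$3 * M$2$0 * M$3$2 + M$0$1 * M$1$3 * M$2$2 * M$3$0
    + M$0$2 * M$1$0 * M$2$1 * M$3$3 - M$0$2 * M$1$0 * M$2$3 * M$3$1
    - M$0$2 * M$1$1 * M$2$0 * M$3$3 + M$0$2 * M$1$1 * M$2$3 * M$3$0
    + M$0$2 * M$1$3 * M$2$0 * M$3$1 - M$0$2 * M$1$3 * M$2$1 * M$3$0
    - M$0$3 * M$1$0 * M$2$1 * M$3$2 + M$0$3 * M$1$0 * M$2$2 * M$3$1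
    + M$0$3 * M$1$1 * M$2$0 * M$3$2 - M$0$3 * M$1$1 * M$2$2 * M$3$0
    - M$0$3 * M$1$2 * M$2$0 * M$3$1 + M$0$3 * M$1$2 * M$2$1 * M$3$0"
proof -
  have f: "finite {2::4, 3, 4}" "1 \<notin> {2::4, 3, 4}" "finite {3::4, 4}" "2 \<notin> {3::4, 4}"
     "finite {4::4}" "3 \<notin> {4::4}" by auto
  show ?thesis
    \<comment> \<open>\<open>UNIV_4\<close> lists the indices as 1, 2, 3, 4;
      \<open>four_eq_0\<close> turns the last one into the index 0 of the statement.\<close>
    unfolding det_def UNIV_4
    unfolding sum_over_permutations_insert[OF f(1,2)]
    unfolding sum_over_permutations_insert[OF f(3,4)]
    unfolding sum_over_permutations_insert[OF f(5,6)]
    unfolding permutes_sing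
    by (simp add: sign_swap_id permutation_swap_id sign_compose swap_id_eq permutation_compose
        four_eq_0 algebra_simps)
qed

lemma axis_wedge_swap:
  "axis {p} (1::real) \<^bold>\<and> axis {q} 1 = - (axis {q} 1 \<^bold>\<and> axis {p} 1)"
  "axis {p} (1::real) \<^bold>\<and> axis {q} 1 \<^bold>\<and> \<omega> = - (axis {q} 1 \<^bold>\<and> axis {p} 1 \<^bold>\<and> \<omega>)"
  by (metis ext_vec_axis wedge_vec_anticomm, metis ext_vec_axis wedge_vec_swap)

lemma axis_wedge_self:
  "axis {p} (1::real) \<^bold>\<and> axis {p} 1 = 0"
  "axis {p} (1::real) \<^bold>\<and> axis {p} 1 \<^bold>\<and> \<omega> = 0"
  by (metis ext_vec_axis wedge_vec_self, metis ext_vec_axis wedge_vec_self_left)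

text \<open>Each swap instance acts only on an inverted pair, so rewriting terminates, with
  \<open>IE\<close> factors before \<open>IE'\<close> factors and indices in the order 1, 2, 3
  within each block.\<close>

lemmas wedge_sort = axis_wedge_self
  axis_wedge_swap[of "IE' j" "IE i" for i j]
  axis_wedge_swap[of "IE 2" "IE 1"] axis_wedge_swap[of "IE 3" "IE 1"] axis_wedge_swap[of "IE 3" "IE 2"]
  axis_wedge_swap[of "IE' 2" "IE' 1"] axis_wedge_swap[of "IE' 3" "IE' 1"] axis_wedge_swap[of "IE' 3" "IE' 2"]

lemma ext_vec_E: "ext_vec (E x) = x $ 1 *\<^sub>R axis {IE 1} 1 + x $ 2 *\<^sub>R axis {IE 2} 1 + x $ 3 *\<^sub>R axis {IE 3} 1"
  and ext_vec_E': "ext_vec (E' x) = x $ 1 *\<^sub>R axis {IE' 1} 1 + x $ 2 *\<^sub>R axis {IE' 2} 1 + x $ 3 *\<^sub>R axis {IE' 3} 1"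
  unfolding E_def E'_def
  by (simp_all add: sum_3 vec_linear_simps)

lemma axis_component: "axis i (1::real) $ j = (if j = i then 1 else 0)"
  by (simp add: axis_def)

text \<open>Trilinearity reduces the claim to basis triples. A triple with a repeated index gives 0
  by alternation; any other is, up to sign, one of the four listed.\<close>

lemma alternating_trilinear_eq_0:
  fixes D :: "real^4 \<Rightarrow> real^4 \<Rightarrow> real^4 \<Rightarrow> 'b::real_vector"
  assumes linear: "\<And>Z W. linear (\<lambda>Y. D Y Z W)"
    and swap12: "\<And>Y Z W. D Y Z W = - D Z Y W"
    and swap23: "\<And>Y Z W. D Y Z W = - D Y W Z"
    and basis: "D (axis 1 1) (axis 2 1) (axis 3 1) = 0" "D (axis 0 1) (axis 2 1) (axis 3 1) = 0"
      "D (axis 0 1) (axis 1 1) (axis 3 1) = 0" "D (axis 0 1) (axis 1 1) (axis 2 1) = 0"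
  shows "D Y Z W = 0"
proof -
  have perm: "D Y W Z = 0" "D Z Y W = 0" "D Z W Y = 0" "D W Y Z = 0" "D W Z Y = 0"
    if "D Y Z W = 0" for Y Z W
    using that swap12 swap23 by (metis neg_equal_0_iff_equal)+
  have self: "D Y Y W = 0" for Y W
    by (rule eq_neg_imp_zero) (rule swap12)
  have "\<forall>i j k. D (axis i 1) (axis j 1) (axis k 1) = 0"
    unfolding forall_4 four_eq_0
    by (simp only: basis basis[THEN perm(1)] basis[THEN perm(2)] basis[THEN perm(3)]
        basis[THEN perm(4)] basis[THEN perm(5)] self self[THEN perm(1)] self[THEN perm(4)] simp_thms)
  note 1 = this[rule_format]
  \<comment> \<open>The swaps carry linearity from the first argument to the other two.\<close>
  have linear2: "linear (\<lambda>Z. D Y Z W)" for Y W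
    unfolding swap12[of Y] by (rule linear_compose_neg[OF linear])
  have linear3: "linear (\<lambda>W. D Y Z W)" for Y Z
    unfolding swap23[of Y Z] by (rule linear_compose_neg[OF linear2])
  have 2: "D (axis i 1) (axis j 1) W = 0" for i j W
    by (rule linear_eq_axis[OF linear3 linear_zero 1])
  have 3: "D (axis i 1) Z W = 0" for i Z W
    by (rule linear_eq_axis[OF linear2 linear_zero 2])
  show ?thesis
    by (rule linear_eq_axis[OF linear linear_zero 3])
qed

definition rows4 :: "'a \<Rightarrow> 'a \<Rightarrow> 'a \<Rightarrow> 'a \<Rightarrow> 'a^4" where
  "rows4 X Y Z W = (\<chi> i. if i = 0 then X else if i = 1 then Y else if i = 2 then Z else W)"

lemma rows4_nth [simp]:
  "rows4 X Y Z W $ 0 = X" "rows4 X Y Z W $ 1 = Y" "rows4 X Y Z W $ 2 = Z" "rows4 X Y Z W $ 3 = W"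
  by (simp_all add: rows4_def)

lemma det_rows4_matrix_mult:
  fixes P :: "real^4^4"
  shows "det (rows4 (P *v X) (P *v Y) (P *v Z) (P *v W)) = det P * det (rows4 X Y Z W)"
proof -
  have "rows4 (P *v X) (P *v Y) (P *v Z) (P *v W) = rows4 X Y Z W ** transpose P"
    by (simp add: rows4_def vec_eq_iff matrix_matrix_mult_def matrix_vector_mult_def transpose_def
        mult.commute)
  then show ?thesis by (simp add: det_mul det_transpose mult.commute)
qed

text \<open>Three standard basis vectors complete \<open>X\<close>: omit the index of a nonzero
  coordinate, and the determinant is that coordinate up to sign.\<close>

lemma ex_det_rows4_nonzero:
  fixes X :: "real^4"
  assumes "X \<noteq> 0"
  obtains Y Z W where "det (rows4 X Y Z W) \<noteq> 0"
proof -
  have "X $ 0 \<noteq> 0 \<or> X $ 1 \<noteq> 0 \<or> X $ 2 \<noteq> 0 \<or> X $ 3 \<noteq> 0"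
    using assms by (auto simp: vec_eq_iff forall_4 four_eq_0)
  moreover have "det (rows4 X (axis 1 1) (axis 2 1) (axis 3 1)) = X $ 0"
    "det (rows4 X (axis 0 1) (axis 2 1) (axis 3 1)) = - X $ 1"
    "det (rows4 X (axis 0 1) (axis 1 1) (axis 3 1)) = X $ 2"
    "det (rows4 X (axis 0 1) (axis 1 1) (axis 2 1)) = - X $ 3"
    by (simp_all add: det_4 axis_def)
  ultimately show ?thesis using that by (metis neg_equal_0_iff_equal)
qed

definition wedge_of_joins :: "real^4 \<Rightarrow> real^4 \<Rightarrow> real^4 \<Rightarrow> real^4 \<Rightarrow> pindex ext" where
  "wedge_of_joins X Y Z W = ext_vec (join X Y) \<^bold>\<and> ext_vec (join X Z) \<^bold>\<and> ext_vec (join X W)"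

text \<open>The scalar factors are the determinants of \<open>rows4 X\<close> followed by the three
  basis vectors. Both sides have coefficients polynomial in the coordinates of \<open>X\<close>,
  compared once the wedge products are sorted.\<close>

lemma wedge_of_joins_basis:
  "wedge_of_joins X (axis 1 1) (axis 2 1) (axis 3 1) = X $ 0 *\<^sub>R \<F> X"
  "wedge_of_joins X (axis 0 1) (axis 2 1) (axis 3 1) = - X $ 1 *\<^sub>R \<F> X"
  "wedge_of_joins X (axis 0 1) (axis 1 1) (axis 3 1) = X $ 2 *\<^sub>R \<F> X"
  "wedge_of_joins X (axis 0 1) (axis 1 1) (axis 2 1) = - X $ 3 *\<^sub>R \<F> X"
  unfolding wedge_of_joins_def \<F>_def Let_def J3_def I3_def K2_def contract33_3 form33_basis
  by (simp_all add: join_def cross3_def spatial_axis ext_vec_E ext_vec_E' vec_linear_simps sum_3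
      spatial_def axis_component form33_def)
    (simp_all add: wedge_linear_simps wedge_sort scaleR_add_right scaleR_diff_right,
     simp_all add: algebra_simps power2_eq_square)

lemma wedge_of_joins_eq: "wedge_of_joins X Y Z W = det (rows4 X Y Z W) *\<^sub>R \<F> X"
proof -
  have "wedge_of_joins X Y Z W - det (rows4 X Y Z W) *\<^sub>R \<F> X = 0"
  proof (rule alternating_trilinear_eq_0[where
        D = "\<lambda>Y Z W. wedge_of_joins X Y Z W - det (rows4 X Y Z W) *\<^sub>R \<F> X"])
    fix Y Z W
    show "linear (\<lambda>Y. wedge_of_joins X Y Z W - det (rows4 X Y Z W) *\<^sub>R \<F> X)"
      by (rule linearI) (simp_all add: wedge_of_joins_def det_4 linear_add[OF linear_join_right]
          linear_scale[OF linear_join_right] vec_linear_simps wedge_linear_simps algebra_simps)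
    have "wedge_of_joins X Z Y W = - wedge_of_joins X Y Z W"
      "wedge_of_joins X Y W Z = - wedge_of_joins X Y Z W"
      unfolding wedge_of_joins_def by (metis wedge_vec_swap, metis wedge_vec_anticomm wedge_linear_simps(10))
    moreover have "det (rows4 X Z Y W) = - det (rows4 X Y Z W)"
      "det (rows4 X Y W Z) = - det (rows4 X Y Z W)"
      by (simp_all add: det_4)
    ultimately show "wedge_of_joins X Y Z W - det (rows4 X Y Z W) *\<^sub>R \<F> X =
        - (wedge_of_joins X Z Y W - det (rows4 X Z Y W) *\<^sub>R \<F> X)"
      "wedge_of_joins X Y Z W - det (rows4 X Y Z W) *\<^sub>R \<F> X =
        - (wedge_of_joins X Y W Z - det (rows4 X Y W Z) *\<^sub>R \<F> X)"
      by simp_all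
  qed (simp_all add: wedge_of_joins_basis det_4 axis_component)
  then show ?thesis by simp
qed

text \<open>This is the dual Pluecker transform of the polarity that sends each basis vector to its
  dual basis form.\<close>

definition interchange :: "R33 \<Rightarrow> R33" where
  "interchange u = (\<chi> p. case p of IE i \<Rightarrow> u $ IE' i | IE' i \<Rightarrow> u $ IE i)"

lemma linear_interchange: "linear interchange"
  by (rule linearI) (simp_all add: interchange_def vec_eq_iff split: pindex.split)

lemma interchange_E [simp]: "interchange (E x) = E' x" "interchange (E' x) = E x"
  by (simp_all add: interchange_def vec_eq_iff split: pindex.split)

lemma meet_eq_interchange_join: "meet \<phi> \<psi> = interchange (join (dual_coords \<phi>) (dual_coords \<psi>))"
  by (simp add: meet_def join_def Let_def linear_add[OF linear_interchange])

lemma ext_map_vec: "linear L \<Longrightarrow> ext_map L (ext_vec v) = ext_vec (L v)"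
  using ext_map_wedge[of L v "axis {} 1"] by (simp add: ext_map_one)

text \<open>The interchange swaps \<open>I3\<close> and \<open>J3\<close> and preserves
  \<open>form33\<close>, hence respects contraction. Anticommutativity sends \<open>K2\<close> to
  \<open>- K2\<close>, which accounts for the opposite signs of the two middle terms.\<close>

lemma \<F>''_eq_interchange: "\<F>'' \<phi> = ext_map interchange (\<F> (dual_coords \<phi>))"
proof -
  have "form33 (E' x) (E y) = form33 (E x) (E' y)" for x y
    by (simp add: form33_def)
  note simps = this linear_add[OF linear_ext_map] linear_diff[OF linear_ext_map]
    linear_scale[OF linear_ext_map] ext_map_wedge[OF linear_interchange] ext_map_vec[OF linear_interchange]
  have "ext_map interchange K2 = - K2"
    by (simp add: K2_def simps linear_sum[OF linear_ext_map] wedge_vec_anticomm[of "E' _" "E _"]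
        sum_negf del: E_axis E'_axis)
  then show ?thesis
    unfolding \<F>_def \<F>''_def Let_def J3_def I3_def contract33_3
    by (simp add: simps wedge_linear_simps del: E_axis E'_axis)
qed

theorem proposition15:
  fixes A :: "real ^ 4 \<Rightarrow> ((real ^ 4) \<Rightarrow>\<^sub>L real)" and X :: "real ^ 4"
  assumes "linear A" and "bij A"
  shows "det (polarity_matrix A) *\<^sub>R \<F>'' (A X) = ext_map (dual_pluecker A) (\<F> X)"
\<comment> \<open>For \<open>X = 0\<close> every determinant \<open>det (rows4 X Y Z W)\<close> is
  zero, so this case is separate; both sides vanish.\<close>
proof (cases "X = 0")
  case True
  note zeros = linear_0[OF linear_dual_coords] linear_0[OF linear_spatial] linear_0[OF linear_E]
    linear_0[OF linear_E'] linear_0[OF linear_ext_vec] linear_0[OF linear_wedge_left]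
    linear_0[OF linear_ext_map] linear_0[OF \<open>linear A\<close>]
  show ?thesis
    by (simp add: True \<F>_def \<F>''_def zeros)
next
  case False
  then obtain Y Z W where nonzero: "det (rows4 X Y Z W) \<noteq> 0"
    by (rule ex_det_rows4_nonzero)
  let ?P = "polarity_matrix A" and ?d = "det (rows4 X Y Z W)"
  note coords = dual_coords_eq_matrix_mult[OF \<open>linear A\<close>]
  have "?d *\<^sub>R ext_map (dual_pluecker A) (\<F> X) = ext_map (dual_pluecker A) (wedge_of_joins X Y Z W)"
    by (simp add: wedge_of_joins_eq linear_scale[OF linear_ext_map])
  \<comment> \<open>Each \<open>join X Y\<close> goes to the meet of \<open>A X\<close> and
    \<open>A Y\<close>, which is the interchanged join of \<open>?P *v X\<close> and
    \<open>?P *v Y\<close>.\<close>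
  also have "\<dots> = ext_map interchange (wedge_of_joins (?P *v X) (?P *v Y) (?P *v Z) (?P *v W))"
    by (simp add: wedge_of_joins_def ext_map_3 linear_dual_pluecker linear_interchange
        dual_pluecker_join[OF \<open>linear A\<close>] meet_eq_interchange_join coords)
  also have "\<dots> = ?d *\<^sub>R (det ?P *\<^sub>R \<F>'' (A X))"
    by (simp add: wedge_of_joins_eq \<F>''_eq_interchange coords det_rows4_matrix_mult
        linear_scale[OF linear_ext_map] mult.commute)
  finally show ?thesis
    using nonzero by (metis scaleR_left_imp_eq)
qed

end
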